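(* In the protocol described in the context, the vectors $z^{\mathsf S}$ and $z^{\mathsf O}$ measured by the third party TP correctly encode the intersection pattern over the augmented domain $\{0,\dots,M-1\}$ under the participant-side label-flip vector $\mathbf b$ (in the sense spelled out at the end of the context).
   Context: Sets and encoding. There are $n$ participants $P_1,\dots,P_n$ and a semi-honest third party TP. The augmented universe is $\widetilde{\mathcal U}=\mathcal U\cup\mathcal A^+\cup\mathcal A^-=\{0,\dots,M-1\}$, where $\mathcal U=\{0,\dots,q-1\}$ is the real domain and the remaining positions are occupied by two anchor sets $\mathcal A^+,\mathcal A^-$. Participant $P_i$ holds a private set $X_i\subseteq\mathcal U$ and sets $\widetilde X_i=X_i\cup\mathcal A^+$. The participants share a key $k\in\mathbb Z_M^*$ (a unit modulo $M$). Define $Y_i\in\{0,1\}^M$ by $Y_{i,t}=1$ if and only if $t=kx\bmod M$ for some $x\in\widetilde X_i$. Angles. The participants share a hidden label-flip vector $\mathbf b=(b_0,\dots,b_{M-1})\in\{0,1\}^M$; put $\Theta_t=b_t\pi$. Participant $P_i$ has rotation shares $\Delta_{i,t}$ with $\sum_{i=1}^n\Delta_{i,t}\equiv\Theta_t\pmod{2\pi}$ for every $t$. TP and $P_i$ share mask angles $T_{i,t}$, and TP has its own blinding angles $\vartheta_{0,t}$. For $1\le i\le n$, $\vartheta_{i,t}=\pi/n$ if $Y_{i,t}=1$ and $\vartheta_{i,t}=0$ otherwise. $R_y(\theta)=\begin{pmatrix}\cos(\theta/2)&-\sin(\theta/2)\\ \sin(\theta/2)&\cos(\theta/2)\end{pmatrix}$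 in the basis $|0\rangle,|1\rangle$. Quantum phase. TP prepares $\ell$ identically configured photon sequences of length $M$; the photon at position $t$ is in a randomly chosen state $|\psi_t\rangle\in\{|0\rangle,|1\rangle,|+\rangle,|-\rangle\}$, where $|\pm\rangle=(|0\rangle\pm|1\rangle)/\sqrt2$, the same in all $\ell$ sequences. To each photon at position $t$ are applied in succession: $R_y(\vartheta_{0,t})$ by TP; $R_y(\vartheta_{i,t}+T_{i,t}+\Delta_{i,t})$ by $P_i$ for $i=1,\dots,n$; and $R_y(-\vartheta_{0,t}-\sum_{i=1}^nT_{i,t})$ by TP. (Decoy photons inserted for eavesdropping checks are removed and play no role here.) TP then measures each photon in the basis of its initial state; an outcome is "same" if it agrees with $|\psi_t\rangle$ and "opposite" if it is the other basis vector. TP sets $z_t^{\mathsf S}=1$ if the $\ell$ outcomes at position $t$ are all "same", $z_t^{\mathsf O}=1$ if they are all "opposite", and $z_t^{\mathsf S}=z_t^{\mathsf O}=0$ otherwise ("mixed"); entries not set to $1$ are $0$. Meaning of "correctly encode the intersection pattern under $\mathbf b$". Let $r_t=\sum_{i=1}^nY_{i,t}$ be the number of participants holding the element encoded at $t$. For every position $t$: if $r_t=0$ (no participant holds it), the position is recorded as all-same when $b_t=0$ and all-opposite when $b_t=1$; if $1\le r_t\le n-1$ (only a nonempty proper subset of the participants holds it), the position is recorded as mixed; if $r_t=n$ (all participants hold it), the position is recorded as all-opposite when $b_t=0$ and all-same when $b_t=1$.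
   Formalization: For finite ℓ a position with 1≤r_t≤n−1 need not be mixed (never if ℓ=1). Proved instead: positions with r_t=0 or n are correct almost surely; the others with probability 1−cos^{2ℓ}(r_tπ/2n)−sin^{2ℓ}(r_tπ/2n); the whole pattern with probability tending to 1 as ℓ→∞. *)

theory Defs
  imports "HOL-Probability.Probability" "HOL-Library.Real_Mod"
begin

section \<open>Set encoding\<close>

definition encode_set :: "nat \<Rightarrow> nat \<Rightarrow> nat set \<Rightarrow> nat \<Rightarrow> nat" where
  "encode_set M k S t = (if \<exists>x\<in>S. t = k * x mod M then 1 else 0)"

definition holders :: "nat \<Rightarrow> (nat \<Rightarrow> nat \<Rightarrow> nat) \<Rightarrow> nat \<Rightarrow> nat" where
  "holders n Y t = (\<Sum>i=1..n. Y i t)"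


section \<open>Qubits\<close>

text \<open>
  A pure qubit state is a unit vector of \<open>complex ^ 2\<close>; component 1 is the amplitude of ket 0 and
  component 2 the amplitude of ket 1.
\<close>

type_synonym qubit = "complex ^ 2"

datatype photon = Ket0 | Ket1 | KetPlus | KetMinus

fun ket :: "photon \<Rightarrow> qubit" where
  "ket Ket0 = vector [1, 0]"
| "ket Ket1 = vector [0, 1]"
| "ket KetPlus = vector [1 / sqrt 2, 1 / sqrt 2]"
| "ket KetMinus = vector [1 / sqrt 2, - (1 / sqrt 2)]"

text \<open>The other vector of the measurement basis that contains the given state.\<close>

fun opposite :: "photon \<Rightarrow> photon" where
  "opposite Ket0 = Ket1"
| "opposite Ket1 = Ket0"
| "opposite KetPlus = KetMinus"
| "opposite KetMinus = KetPlus"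

definition Ry :: "real \<Rightarrow> complex ^ 2 ^ 2" where
  "Ry \<theta> = vector
     [vector [complex_of_real (cos (\<theta> / 2)), - complex_of_real (sin (\<theta> / 2))],
      vector [complex_of_real (sin (\<theta> / 2)), complex_of_real (cos (\<theta> / 2))]]"

text \<open>
  The Hermitian inner product, conjugate-linear in its first argument. (The library inner product
  on this type is only its real part.)
\<close>

definition braket :: "qubit \<Rightarrow> qubit \<Rightarrow> complex" where
  "braket u v = (\<Sum>i\<in>UNIV. cnj (u $ i) * v $ i)"

datatype outcome = Same | Opposite

fun outcome_ket :: "photon \<Rightarrow> outcome \<Rightarrow> qubit" where
  "outcome_ket p Same = ket p"
| "outcome_ket p Opposite = ket (opposite p)"

text \<open>
  Born rule for measuring the state \<open>v\<close> in the basis of \<open>p\<close>. The weights sum to 1 for unit vectors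
  \<open>v\<close>, see \<open>pmf_measurement\<close> below; all states that occur are unit vectors, see
  \<open>norm_final_state\<close>.
\<close>

definition measurement :: "photon \<Rightarrow> qubit \<Rightarrow> outcome pmf" where
  "measurement p v = embed_pmf (\<lambda>c. (cmod (braket (outcome_ket p c) v))\<^sup>2)"


section \<open>The quantum phase\<close>

definition part_angle :: "nat \<Rightarrow> (nat \<Rightarrow> nat \<Rightarrow> nat) \<Rightarrow> nat \<Rightarrow> nat \<Rightarrow> real" where
  "part_angle n Y i t = (if Y i t = 1 then pi / real n else 0)"

text \<open>
  State of a photon at position \<open>t\<close> just before its measurement. The rotations are applied one
  after the other: TP, then participants \<open>1, \<dots>, n\<close> in this order, then TP again.
\<close>

definition final_state ::
  "nat \<Rightarrow> (nat \<Rightarrow> nat \<Rightarrow> nat) \<Rightarrow> (nat \<Rightarrow> nat \<Rightarrow> real) \<Rightarrow> (nat \<Rightarrow> nat \<Rightarrow> real) \<Rightarrow> (nat \<Rightarrow> real) \<Rightarrow>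
   (nat \<Rightarrow> photon) \<Rightarrow> nat \<Rightarrow> qubit" where
  "final_state n Y T \<Delta> \<theta>0 \<psi> t =
     Ry (- \<theta>0 t - (\<Sum>i=1..n. T i t)) *v
       fold (\<lambda>i v. Ry (part_angle n Y i t + T i t + \<Delta> i t) *v v) [1..<Suc n]
         (Ry (\<theta>0 t) *v ket (\<psi> t))"

text \<open>
  Joint distribution of all outcomes: \<open>\<omega> (j, t)\<close> is the outcome for the photon at position \<open>t\<close> of
  the \<open>j\<close>-th sequence. The photons are in a product state and are measured separately, so their
  outcomes are independent. The value \<open>Same\<close> given to \<open>Pi_pmf\<close> is a dummy value for indices outside
  the range.
\<close>

definition run ::
  "nat \<Rightarrow> nat \<Rightarrow> (nat \<Rightarrow> nat \<Rightarrow> nat) \<Rightarrow> (nat \<Rightarrow> nat \<Rightarrow> real) \<Rightarrow> (nat \<Rightarrow> nat \<Rightarrow> real) \<Rightarrow> (nat \<Rightarrow> real) \<Rightarrow>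
   (nat \<Rightarrow> photon) \<Rightarrow> nat \<Rightarrow> (nat \<times> nat \<Rightarrow> outcome) pmf" where
  "run n M Y T \<Delta> \<theta>0 \<psi> l =
     Pi_pmf ({..<l} \<times> {..<M}) Same
       (\<lambda>(j, t). measurement (\<psi> t) (final_state n Y T \<Delta> \<theta>0 \<psi> t))"

definition zS :: "nat \<Rightarrow> (nat \<times> nat \<Rightarrow> outcome) \<Rightarrow> nat \<Rightarrow> nat" where
  "zS l \<omega> t = (if \<forall>j<l. \<omega> (j, t) = Same then 1 else 0)"

definition zO :: "nat \<Rightarrow> (nat \<times> nat \<Rightarrow> outcome) \<Rightarrow> nat \<Rightarrow> nat" where
  "zO l \<omega> t = (if \<forall>j<l. \<omega> (j, t) = Opposite then 1 else 0)"


section \<open>Correct encoding\<close>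

definition all_same :: "(nat \<Rightarrow> nat) \<Rightarrow> (nat \<Rightarrow> nat) \<Rightarrow> nat \<Rightarrow> bool" where
  "all_same s d t \<longleftrightarrow> s t = 1 \<and> d t = 0"

definition all_opposite :: "(nat \<Rightarrow> nat) \<Rightarrow> (nat \<Rightarrow> nat) \<Rightarrow> nat \<Rightarrow> bool" where
  "all_opposite s d t \<longleftrightarrow> s t = 0 \<and> d t = 1"

definition mixed :: "(nat \<Rightarrow> nat) \<Rightarrow> (nat \<Rightarrow> nat) \<Rightarrow> nat \<Rightarrow> bool" where
  "mixed s d t \<longleftrightarrow> s t = 0 \<and> d t = 0"

definition position_correct ::
  "nat \<Rightarrow> (nat \<Rightarrow> nat) \<Rightarrow> (nat \<Rightarrow> nat) \<Rightarrow> (nat \<Rightarrow> nat) \<Rightarrow> (nat \<Rightarrow> nat) \<Rightarrow> nat \<Rightarrow> bool" where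
  "position_correct n r b s d t \<longleftrightarrow>
     (r t = 0 \<longrightarrow> (b t = 0 \<longrightarrow> all_same s d t) \<and> (b t = 1 \<longrightarrow> all_opposite s d t)) \<and>
     (1 \<le> r t \<and> r t \<le> n - 1 \<longrightarrow> mixed s d t) \<and>
     (r t = n \<longrightarrow> (b t = 0 \<longrightarrow> all_opposite s d t) \<and> (b t = 1 \<longrightarrow> all_same s d t))"

definition correctly_encodes ::
  "nat \<Rightarrow> nat \<Rightarrow> (nat \<Rightarrow> nat) \<Rightarrow> (nat \<Rightarrow> nat) \<Rightarrow> (nat \<Rightarrow> nat) \<Rightarrow> (nat \<Rightarrow> nat) \<Rightarrow> bool" where
  "correctly_encodes n M r b s d \<longleftrightarrow> (\<forall>t<M. position_correct n r b s d t)"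


section \<open>The measurement distribution is well defined\<close>

lemma cmod_sq_sum: "(cmod x)\<^sup>2 + (cmod y)\<^sup>2 = 1" if "norm v = 1" "x = v $ 1" "y = v $ 2"
    for v :: qubit and x y
  using that by (simp add: norm_vec_def L2_set_def sum_2)

lemma norm_ket: "norm (ket p) = 1"
  by (cases p) (simp_all add: norm_vec_def L2_set_def sum_2 norm_divide power_divide)

lemma norm_Ry: "norm (Ry \<theta> *v v) = norm v"
proof -
  define c s where "c = cos (\<theta> / 2)" and "s = sin (\<theta> / 2)"
  have cs: "c\<^sup>2 + s\<^sup>2 = 1" by (simp add: c_def s_def)
  have "(cmod (c * x - s * y))\<^sup>2 + (cmod (s * x + c * y))\<^sup>2 = (cmod x)\<^sup>2 + (cmod y)\<^sup>2" for x y :: complex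
  proof -
    have "(cmod (c * x - s * y))\<^sup>2 + (cmod (s * x + c * y))\<^sup>2
            = (c\<^sup>2 + s\<^sup>2) * ((cmod x)\<^sup>2 + (cmod y)\<^sup>2)"
      unfolding cmod_power2 by (simp add: power2_eq_square algebra_simps)
    then show ?thesis using cs by simp
  qed
  from this[of "v $ 1" "v $ 2"] show ?thesis
    by (simp add: norm_vec_def L2_set_def sum_2 Ry_def matrix_vector_mult_def
          flip: c_def s_def)
qed

lemma norm_final_state: "norm (final_state n Y T \<Delta> \<theta>0 \<psi> t) = 1"
proof -
  have "norm (fold (\<lambda>i v. Ry (f i) *v v) is v) = norm v" for f :: "nat \<Rightarrow> real" and "is" v
    by (induction "is" arbitrary: v) (simp_all add: norm_Ry)
  then show ?thesis by (simp add: final_state_def norm_Ry norm_ket del: upt_Suc)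
qed

lemma UNIV_outcome: "UNIV = {Same, Opposite}"
  using outcome.exhaust by auto

lemma born_sum:
  assumes "norm v = 1"
  shows "(cmod (braket (ket p) v))\<^sup>2 + (cmod (braket (ket (opposite p)) v))\<^sup>2 = 1"
proof -
  have 1: "(cmod (v $ 1))\<^sup>2 + (cmod (v $ 2))\<^sup>2 = 1" using cmod_sq_sum[OF assms] by simp
  have 2: "(cmod (x / sqrt 2 + y / sqrt 2))\<^sup>2 + (cmod (x / sqrt 2 - y / sqrt 2))\<^sup>2
             = (cmod x)\<^sup>2 + (cmod y)\<^sup>2" for x y :: complex
  proof -
    have "x / sqrt 2 + y / sqrt 2 = (x + y) / sqrt 2" "x / sqrt 2 - y / sqrt 2 = (x - y) / sqrt 2"
      by (simp_all add: add_divide_distrib diff_divide_distrib)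
    then have "(cmod (x / sqrt 2 + y / sqrt 2))\<^sup>2 + (cmod (x / sqrt 2 - y / sqrt 2))\<^sup>2
        = ((cmod (x + y))\<^sup>2 + (cmod (x - y))\<^sup>2) / 2"
      by (simp only: norm_divide power_divide) (simp add: add_divide_distrib)
    also have "(cmod (x + y))\<^sup>2 + (cmod (x - y))\<^sup>2 = 2 * ((cmod x)\<^sup>2 + (cmod y)\<^sup>2)"
      unfolding cmod_power2 by (simp add: power2_eq_square algebra_simps)
    finally show ?thesis by simp
  qed
  show ?thesis
    using 1 2[of "v $ 1" "v $ 2"] by (cases p) (simp_all add: braket_def sum_2 add.commute)
qed

lemma pmf_measurement:
  assumes "norm v = 1"
  shows "pmf (measurement p v) c = (cmod (braket (outcome_ket p c) v))\<^sup>2"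
  unfolding measurement_def
proof (rule pmf_embed_pmf)
  show "(\<integral>\<^sup>+c. ennreal ((cmod (braket (outcome_ket p c) v))\<^sup>2) \<partial>count_space UNIV) = 1"
    using born_sum[OF assms, of p]
    by (subst nn_integral_count_space_finite)
       (simp_all add: UNIV_outcome flip: ennreal_plus)
qed simp

end

theory Submission
  imports Defs
begin

text \<open>
  Rotations \<open>Ry\<close> add up, so every mask cancels and the photon at position \<open>t\<close> is rotated by
  \<open>r\<^sub>t \<pi> / n + b\<^sub>t \<pi>\<close> modulo \<open>2 \<pi>\<close>. All four initial states are real and the opposite vector is the
  rotation by \<open>\<pi>\<close> up to sign, so ``same'' has probability \<open>cos\<^sup>2\<close> and ``opposite'' \<open>sin\<^sup>2\<close> of half
  that angle. At \<open>r\<^sub>t = 0\<close> and \<open>r\<^sub>t = n\<close> the outcome is deterministic; otherwise both probabilities are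
  below 1, and by independence the \<open>l\<close> outcomes agree with a probability that decays geometrically
  in \<open>l\<close>. A union bound over the positions gives the limit.
\<close>

lemma Ry_add: "Ry x *v (Ry y *v v) = Ry (x + y) *v v"
proof -
  have "cos ((x + y) / 2) = cos (x / 2) * cos (y / 2) - sin (x / 2) * sin (y / 2)"
    and "sin ((x + y) / 2) = sin (x / 2) * cos (y / 2) + cos (x / 2) * sin (y / 2)"
    by (simp_all add: add_divide_distrib cos_add sin_add)
  note angle_sum = this
  show ?thesis
    unfolding Ry_def angle_sum
    by (simp add: vec_eq_iff forall_2 matrix_vector_mult_def sum_2 algebra_simps)
qed

text \<open>The start vector has the form \<open>Ry x *v v\<close>, so \<open>Ry_add\<close> absorbs
  each further rotation into \<open>x\<close>; this is why the induction runs over arbitrary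
  \<open>x\<close>.\<close>

lemma fold_Ry:
  "fold (\<lambda>i v. Ry (f i) *v v) is (Ry x *v v) = Ry (sum_list (map f is) + x) *v v"
  by (induction "is" arbitrary: x) (simp_all add: Ry_add add_ac)

lemma final_state_eq:
  "final_state n Y T \<Delta> \<theta>0 \<psi> t =
     Ry ((\<Sum>i=1..n. part_angle n Y i t) + (\<Sum>i=1..n. \<Delta> i t)) *v ket (\<psi> t)"
proof -
  have "{1..<Suc n} = {1..n}" by auto
  then show ?thesis
    unfolding final_state_def fold_Ry Ry_add
    by (simp add: sum_list_distinct_conv_sum_set sum.distrib del: upt_Suc)
qed

text \<open>On 0/1 values \<open>part_angle\<close> is linear in \<open>Y i t\<close> with slope
  \<open>pi / real n\<close>, so the sum only sees the number of holders.\<close>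

lemma part_angle_sum:
  assumes "\<And>i. i \<in> {1..n} \<Longrightarrow> Y i t \<in> {0, 1}"
  shows "(\<Sum>i=1..n. part_angle n Y i t) = real (holders n Y t) * pi / real n"
proof -
  have "(\<Sum>i=1..n. part_angle n Y i t) = (\<Sum>i=1..n. real (Y i t) * (pi / real n))"
    using assms by (intro sum.cong) (force simp: part_angle_def)+
  then show ?thesis
    by (simp only: holders_def of_nat_sum times_divide_eq_right sum_distrib_right sum_divide_distrib)
qed

text \<open>\<open>Ry \<theta>\<close> is \<open>cos (\<theta> / 2)\<close> times the identity plus
  \<open>sin (\<theta> / 2)\<close> times a skew-symmetric matrix. The kets are real unit vectors,
  so the skew part contributes nothing to the inner product.\<close>

lemma pmf_measurement_Same:
  "pmf (measurement p (Ry \<theta> *v ket p)) Same = (cos (\<theta> / 2))\<^sup>2"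
proof -
  have "braket (ket p) (Ry \<theta> *v ket p) = complex_of_real (cos (\<theta> / 2))"
    by (cases p) (simp_all add: braket_def sum_2 Ry_def matrix_vector_mult_def field_simps
        flip: of_real_mult mult.assoc)
  then show ?thesis by (simp add: pmf_measurement norm_Ry norm_ket)
qed

lemma pmf_outcome_sum: "pmf P Same + pmf P Opposite = 1"
  using sum_pmf_eq_1[of UNIV P] by (simp flip: UNIV_outcome) (simp add: UNIV_outcome)

text \<open>\<open>a\<close> is half of the angle contributed by the sets, because \<open>Ry\<close>
  works with half angles. A flip \<open>b = 1\<close> adds \<pi>/2 to it and so exchanges cos^2 and
  sin^2; the conditionals in the conclusions record this exchange.\<close>

lemma pmf_measurement_final_state:
  fixes b :: nat and T \<Delta> :: "nat \<Rightarrow> nat \<Rightarrow> real" and \<theta>0 :: "nat \<Rightarrow> real" and \<psi> :: "nat \<Rightarrow> photon"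
  assumes "n \<ge> 1" and "\<And>i. i \<in> {1..n} \<Longrightarrow> Y i t \<in> {0, 1}"
    and "b \<in> {0, 1}" and "[(\<Sum>i=1..n. \<Delta> i t) = real b * pi] (rmod (2 * pi))"
  defines "a \<equiv> real (holders n Y t) * pi / (2 * real n)"
    and "P \<equiv> measurement (\<psi> t) (final_state n Y T \<Delta> \<theta>0 \<psi> t)"
  shows "pmf P (if b = 0 then Same else Opposite) = (cos a)\<^sup>2"
    and "pmf P (if b = 0 then Opposite else Same) = (sin a)\<^sup>2"
proof -
  define S where "S = (\<Sum>i=1..n. \<Delta> i t)"
  have S: "[real b * pi = S] (rmod (2 * pi))"
    using assms(4) unfolding S_def by (rule rcong_sym)
  obtain m :: int where m: "S = real b * pi + of_int m * (2 * pi)"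
    using S unfolding rcong_altdef by blast
  have "final_state n Y T \<Delta> \<theta>0 \<psi> t = Ry (2 * a + S) *v ket (\<psi> t)"
    using assms(1) part_angle_sum[of n Y t, OF assms(2)] by (simp add: final_state_eq a_def S_def)
  then have "pmf P Same = (cos ((2 * a + S) / 2))\<^sup>2"
    by (simp add: P_def pmf_measurement_Same)
  \<comment> \<open>Halving turns the multiple of 2 \<pi> into a multiple of \<pi>, which can only
    change the sign of the cosine; the square removes it.\<close>
  also have "(2 * a + S) / 2 = a + real b * pi / 2 + of_int m * pi"
    by (simp add: m field_simps)
  also have "(cos (a + real b * pi / 2 + of_int m * pi))\<^sup>2 = (cos (a + real b * pi / 2))\<^sup>2"
    by (simp add: cos_add[of "a + real b * pi / 2"] power_mult_distrib
        cos_squared_eq[of "of_int m * pi"] mult.commute[of "of_int m" pi] del: cos_int_times_real)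
  finally have 1: "pmf P Same = (cos (a + real b * pi / 2))\<^sup>2" .
  have 2: "pmf P Opposite = 1 - pmf P Same" using pmf_outcome_sum[of P] by simp
  show "pmf P (if b = 0 then Same else Opposite) = (cos a)\<^sup>2"
    and "pmf P (if b = 0 then Opposite else Same) = (sin a)\<^sup>2"
    using assms(3) 1 2 by (auto simp: cos_add cos_squared_eq)
qed

text \<open>The event is a box in a product space: photons at other positions are free and give a
  factor 1, while the \<open>l\<close> photons at \<open>t\<close> are identically distributed and
  give a power.\<close>

lemma prob_all_outcomes:
  assumes "t < M"
  shows "measure_pmf.prob (run n M Y T \<Delta> \<theta>0 \<psi> l) {\<omega>. \<forall>j<l. \<omega> (j, t) = c}
    = pmf (measurement (\<psi> t) (final_state n Y T \<Delta> \<theta>0 \<psi> t)) c ^ l"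
proof -
  let ?A = "{..<l} \<times> {..<M}" and ?B = "\<lambda>(j, u). if u = t then {c} else UNIV"
  let ?P = "\<lambda>u. measurement (\<psi> u) (final_state n Y T \<Delta> \<theta>0 \<psi> u)"
  have "{\<omega>. \<forall>j<l. \<omega> (j, t) = c} = Pi ?A ?B"
    using assms by (auto simp: Pi_def)
  then have "measure_pmf.prob (run n M Y T \<Delta> \<theta>0 \<psi> l) {\<omega>. \<forall>j<l. \<omega> (j, t) = c}
      = (\<Prod>x\<in>?A. measure_pmf.prob (case x of (j, u) \<Rightarrow> ?P u) (?B x))"
    by (simp add: run_def measure_Pi_pmf_Pi)
  also have "\<dots> = (\<Prod>j<l. \<Prod>u<M. if u = t then pmf (?P t) c else 1)"
    unfolding prod.cartesian_product
    by (intro prod.cong) (auto simp: measure_pmf_single)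
  also have "\<dots> = pmf (?P t) c ^ l"
    using assms by (simp add: prod.delta)
  finally show ?thesis .
qed

lemma AE_all_outcomes:
  assumes "t < M" and "pmf (measurement (\<psi> t) (final_state n Y T \<Delta> \<theta>0 \<psi> t)) c = 1"
  shows "AE \<omega> in measure_pmf (run n M Y T \<Delta> \<theta>0 \<psi> l). \<forall>j<l. \<omega> (j, t) = c"
proof -
  let ?R = "run n M Y T \<Delta> \<theta>0 \<psi> l"
  have "measure_pmf.prob ?R {\<omega>. \<forall>j<l. \<omega> (j, t) = c} = 1"
    using assms by (simp add: prob_all_outcomes)
  then show ?thesis by (simp add: measure_pmf.prob_eq_1)
qed

text \<open>For \<open>l \<ge> 1\<close> photon 0 separates the two unanimous events, so their
  probabilities add and the complement carries the rest.\<close>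

lemma prob_not_all_outcomes:
  fixes n :: nat and Y :: "nat \<Rightarrow> nat \<Rightarrow> nat" and T \<Delta> :: "nat \<Rightarrow> nat \<Rightarrow> real" and \<theta>0 :: "nat \<Rightarrow> real"
    and \<psi> :: "nat \<Rightarrow> photon"
  assumes "t < M" and "l \<ge> 1" and "c \<noteq> c'"
  defines "P \<equiv> measurement (\<psi> t) (final_state n Y T \<Delta> \<theta>0 \<psi> t)"
  shows "measure_pmf.prob (run n M Y T \<Delta> \<theta>0 \<psi> l)
      {\<omega>. \<not> (\<forall>j<l. \<omega> (j, t) = c) \<and> \<not> (\<forall>j<l. \<omega> (j, t) = c')} = 1 - pmf P c ^ l - pmf P c' ^ l"
proof -
  let ?R = "run n M Y T \<Delta> \<theta>0 \<psi> l" and ?E = "\<lambda>c. {\<omega>. \<forall>j<l. \<omega> (j, t) = c}"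
  have "?E c \<inter> ?E c' = {}" using assms(2,3) by fastforce
  then have "measure_pmf.prob ?R (?E c \<union> ?E c') = pmf P c ^ l + pmf P c' ^ l"
    unfolding P_def prob_all_outcomes[OF assms(1), symmetric]
    by (intro measure_pmf.finite_measure_Union) auto
  moreover have "{\<omega>. \<not> (\<forall>j<l. \<omega> (j, t) = c) \<and> \<not> (\<forall>j<l. \<omega> (j, t) = c')}
      = space (measure_pmf ?R) - (?E c \<union> ?E c')" by auto
  ultimately show ?thesis
    by (simp add: measure_pmf.prob_compl del: space_measure_pmf)
qed

text \<open>With \<open>l = 0\<close> both vectors would be 1 vacuously; \<open>l \<ge> 1\<close>
  supplies photon 0, which cannot show both outcomes at once.\<close>

lemma all_same_zS_zO: "l \<ge> 1 \<Longrightarrow> all_same (zS l \<omega>) (zO l \<omega>) t \<longleftrightarrow> (\<forall>j<l. \<omega> (j, t) = Same)"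
  and all_opposite_zS_zO:
    "l \<ge> 1 \<Longrightarrow> all_opposite (zS l \<omega>) (zO l \<omega>) t \<longleftrightarrow> (\<forall>j<l. \<omega> (j, t) = Opposite)"
  and mixed_zS_zO: "mixed (zS l \<omega>) (zO l \<omega>) t \<longleftrightarrow>
    \<not> (\<forall>j<l. \<omega> (j, t) = Same) \<and> \<not> (\<forall>j<l. \<omega> (j, t) = Opposite)"
  unfolding all_same_def all_opposite_def mixed_def zS_def zO_def
  by (auto intro: exI[of _ 0])

text \<open>At a position held by a nonempty proper subset, the \<open>l\<close> outcomes agree by
  chance with positive probability. Hence the split: almost sure correctness where nobody or
  everybody holds the element, an exact success probability in between, and full correctness in the
  limit.\<close>

theorem theorem1:
  fixes n q M k :: nat
    and Apos Aneg :: "nat set"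
    and X :: "nat \<Rightarrow> nat set"
    and Y :: "nat \<Rightarrow> nat \<Rightarrow> nat"
    and b :: "nat \<Rightarrow> nat"
    and \<Delta> T :: "nat \<Rightarrow> nat \<Rightarrow> real"
    and \<theta>0 :: "nat \<Rightarrow> real"
    and \<psi> :: "nat \<Rightarrow> photon"
  assumes "n \<ge> 1"
    and "q \<le> M" and "Apos \<union> Aneg = {q..<M}"
    and "\<And>i. i \<in> {1..n} \<Longrightarrow> X i \<subseteq> {0..<q}"
    and "k < M" and "coprime k M"
    and "\<And>i t. i \<in> {1..n} \<Longrightarrow> t < M \<Longrightarrow> Y i t = encode_set M k (X i \<union> Apos) t"
    and "\<And>t. t < M \<Longrightarrow> b t \<in> {0, 1}"
    and "\<And>t. t < M \<Longrightarrow> [(\<Sum>i=1..n. \<Delta> i t) = real (b t) * pi] (rmod (2 * pi))"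
  shows "(\<forall>l\<ge>1. AE \<omega> in measure_pmf (run n M Y T \<Delta> \<theta>0 \<psi> l). \<forall>t<M.
            holders n Y t \<in> {0, n} \<longrightarrow>
              position_correct n (holders n Y) b (zS l \<omega>) (zO l \<omega>) t) \<and>
         (\<forall>l\<ge>1. \<forall>t<M. 1 \<le> holders n Y t \<and> holders n Y t \<le> n - 1 \<longrightarrow>
            measure_pmf.prob (run n M Y T \<Delta> \<theta>0 \<psi> l)
              {\<omega>. position_correct n (holders n Y) b (zS l \<omega>) (zO l \<omega>) t}
            = 1 - cos (real (holders n Y t) * pi / (2 * real n)) ^ (2 * l)
                - sin (real (holders n Y t) * pi / (2 * real n)) ^ (2 * l)) \<and>
         ((\<lambda>l. measure_pmf.prob (run n M Y T \<Delta> \<theta>0 \<psi> l)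
             {\<omega>. correctly_encodes n M (holders n Y) b (zS l \<omega>) (zO l \<omega>)}) \<longlonglongrightarrow> 1)"
proof -
  let ?R = "run n M Y T \<Delta> \<theta>0 \<psi>"
  let ?r = "holders n Y"
  let ?a = "\<lambda>t. real (?r t) * pi / (2 * real n)"
  let ?P = "\<lambda>t. measurement (\<psi> t) (final_state n Y T \<Delta> \<theta>0 \<psi> t)"
  let ?ok = "\<lambda>l \<omega> t. position_correct n ?r b (zS l \<omega>) (zO l \<omega>) t"
  have Y01: "Y i t \<in> {0, 1}" if "i \<in> {1..n}" "t < M" for i t
    using assms(7)[OF that] by (simp add: encode_set_def)
  have r_le: "?r t \<le> n" if "t < M" for t
  proof -
    have "?r t \<le> (\<Sum>i=1..n. 1)"
      unfolding holders_def using Y01[OF _ that] by (intro sum_mono) fastforce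
    then show ?thesis by simp
  qed
  have P: "pmf (?P t) (if b t = 0 then Same else Opposite) = (cos (?a t))\<^sup>2"
    "pmf (?P t) (if b t = 0 then Opposite else Same) = (sin (?a t))\<^sup>2" if "t < M" for t
    using pmf_measurement_final_state[where Y = Y and \<Delta> = \<Delta> and t = t,
        OF \<open>n \<ge> 1\<close> Y01[OF _ that] assms(8)[OF that] assms(9)[OF that]]
    by blast+

  have AE: "AE \<omega> in measure_pmf (?R l). ?ok l \<omega> t"
    if t: "t < M" and "l \<ge> 1" and r: "?r t \<in> {0, n}" for l t
  proof -
    \<comment> \<open>The only possible outcome: \<open>b t = 1\<close> flips it, and so does
      \<open>?r t = n\<close>, where the sets rotate by \<pi>. Two flips cancel.\<close>
    define c where "c = (if (?r t = 0) = (b t = 0) then Same else Opposite)"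
    have "pmf (?P t) c = 1"
      using P[OF t] r \<open>n \<ge> 1\<close> by (auto simp: c_def split: if_splits)
    then have "AE \<omega> in measure_pmf (?R l). \<forall>j<l. \<omega> (j, t) = c"
      by (rule AE_all_outcomes[OF t])
    then show ?thesis
    proof (eventually_elim)
      case (elim \<omega>)
      then show ?case
        using r \<open>n \<ge> 1\<close> \<open>l \<ge> 1\<close> assms(8)[OF t]
        by (auto simp: position_correct_def all_same_zS_zO all_opposite_zS_zO c_def
            split: if_splits)
    qed
  qed

  have prob: "measure_pmf.prob (?R l) {\<omega>. ?ok l \<omega> t}
      = 1 - cos (?a t) ^ (2 * l) - sin (?a t) ^ (2 * l)"
    if t: "t < M" and "l \<ge> 1" and r: "1 \<le> ?r t" "?r t \<le> n - 1" for l t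
  proof -
    have "?ok l \<omega> t \<longleftrightarrow> mixed (zS l \<omega>) (zO l \<omega>) t" for \<omega>
      using r by (auto simp: position_correct_def)
    then have "measure_pmf.prob (?R l) {\<omega>. ?ok l \<omega> t}
        = 1 - pmf (?P t) Same ^ l - pmf (?P t) Opposite ^ l"
      using prob_not_all_outcomes[OF t \<open>l \<ge> 1\<close>, of Same Opposite] by (simp add: mixed_zS_zO)
    \<comment> \<open>The flip only swaps the two summands, so the sum does not depend on
      \<open>b t\<close>.\<close>
    also have "pmf (?P t) Same ^ l + pmf (?P t) Opposite ^ l
        = cos (?a t) ^ (2 * l) + sin (?a t) ^ (2 * l)"
      using P[OF t] by (simp add: power_mult split: if_splits)
    ultimately show ?thesis by simp
  qed

  have bad_lim: "(\<lambda>l. measure_pmf.prob (?R l) {\<omega>. \<not> ?ok l \<omega> t}) \<longlonglongrightarrow> 0" if t: "t < M" for t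
  proof -
    have compl: "measure_pmf.prob (?R l) {\<omega>. \<not> ?ok l \<omega> t}
        = 1 - measure_pmf.prob (?R l) {\<omega>. ?ok l \<omega> t}" for l
      using measure_pmf.prob_neg[of "?R l" "\<lambda>\<omega>. ?ok l \<omega> t"] by simp
    show ?thesis
    proof (cases "?r t \<in> {0, n}")
      case True
      have "measure_pmf.prob (?R l) {\<omega>. ?ok l \<omega> t} = 1" if "l \<ge> 1" for l
        using AE[OF t that True] by (subst measure_pmf.prob_eq_1) simp_all
      then have "\<forall>\<^sub>F l in sequentially. measure_pmf.prob (?R l) {\<omega>. \<not> ?ok l \<omega> t} = 0"
        by (intro eventually_sequentiallyI[of 1]) (simp add: compl)
      then show ?thesis by (rule tendsto_eventually)
    next
      case False
      then have r: "1 \<le> ?r t" "?r t \<le> n - 1" using r_le[OF t] by auto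
      \<comment> \<open>Strictly inside the first quadrant sine and cosine are both positive. Their
        squares add up to 1, so each is below 1 and its powers tend to 0.\<close>
      then have a: "0 < ?a t" "?a t < pi / 2" using \<open>n \<ge> 1\<close> by (auto simp: field_simps)
      have "0 < cos (?a t)" "0 < sin (?a t)"
        using cos_gt_zero[OF a] sin_gt_zero2[OF a] by blast+
      then have "0 < (cos (?a t))\<^sup>2" "0 < (sin (?a t))\<^sup>2"
        by (simp_all only: zero_less_power)
      then have "(cos (?a t))\<^sup>2 < 1" "(sin (?a t))\<^sup>2 < 1"
        using sin_cos_squared_add[of "?a t"] by linarith+
      then have "(\<lambda>l. ((cos (?a t))\<^sup>2) ^ l + ((sin (?a t))\<^sup>2) ^ l) \<longlonglongrightarrow> 0 + 0"
        by (intro tendsto_add LIMSEQ_power_zero) simp_all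
      moreover have "\<forall>\<^sub>F l in sequentially. ((cos (?a t))\<^sup>2) ^ l + ((sin (?a t))\<^sup>2) ^ l
          = measure_pmf.prob (?R l) {\<omega>. \<not> ?ok l \<omega> t}"
        using prob[OF t _ r]
        by (intro eventually_sequentiallyI[of 1]) (simp add: compl power_mult)
      ultimately show ?thesis by (simp add: Lim_transform_eventually)
    qed
  qed

  have "(\<lambda>l. measure_pmf.prob (?R l) {\<omega>. correctly_encodes n M ?r b (zS l \<omega>) (zO l \<omega>)}) \<longlonglongrightarrow> 1"
  proof (rule tendsto_sandwich[where h = "\<lambda>_. 1"])
    \<comment> \<open>The lower bound is the union bound over failing positions. \<open>M\<close> is
      fixed while \<open>l\<close> grows, so the termwise limits \<open>bad_lim\<close>
      suffice.\<close>
    have "(\<lambda>l. 1 - (\<Sum>t<M. measure_pmf.prob (?R l) {\<omega>. \<not> ?ok l \<omega> t})) \<longlonglongrightarrow> 1 - (\<Sum>t<M. 0)"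
      using bad_lim by (intro tendsto_diff tendsto_sum) auto
    then show "(\<lambda>l. 1 - (\<Sum>t<M. measure_pmf.prob (?R l) {\<omega>. \<not> ?ok l \<omega> t})) \<longlonglongrightarrow> 1" by simp
    show "\<forall>\<^sub>F l in sequentially. 1 - (\<Sum>t<M. measure_pmf.prob (?R l) {\<omega>. \<not> ?ok l \<omega> t})
        \<le> measure_pmf.prob (?R l) {\<omega>. correctly_encodes n M ?r b (zS l \<omega>) (zO l \<omega>)}"
    proof (intro always_eventually allI)
      fix l
      let ?E = "{\<omega>. correctly_encodes n M ?r b (zS l \<omega>) (zO l \<omega>)}"
      have "measure_pmf.prob (?R l) (- ?E) = 1 - measure_pmf.prob (?R l) ?E"
        using measure_pmf.prob_compl[of ?E "?R l"] by (simp add: Compl_eq_Diff_UNIV)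
      moreover have "- ?E = (\<Union>t<M. {\<omega>. \<not> ?ok l \<omega> t})"
        by (auto simp: correctly_encodes_def)
      moreover have "measure_pmf.prob (?R l) (\<Union>t<M. {\<omega>. \<not> ?ok l \<omega> t})
          \<le> (\<Sum>t<M. measure_pmf.prob (?R l) {\<omega>. \<not> ?ok l \<omega> t})"
        by (intro measure_pmf.finite_measure_subadditive_finite) auto
      ultimately show "1 - (\<Sum>t<M. measure_pmf.prob (?R l) {\<omega>. \<not> ?ok l \<omega> t})
          \<le> measure_pmf.prob (?R l) ?E" by simp
    qed
  qed (simp_all add: measure_pmf.prob_le_1)
  moreover have "AE \<omega> in measure_pmf (?R l). \<forall>t<M. ?r t \<in> {0, n} \<longrightarrow> ?ok l \<omega> t"
    if "l \<ge> 1" for l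
  proof -
    have "AE \<omega> in measure_pmf (?R l). \<forall>t\<in>{..<M}. ?r t \<in> {0, n} \<longrightarrow> ?ok l \<omega> t"
      using AE[OF _ that] by (intro AE_finite_allI) auto
    then show ?thesis by (simp only: Ball_def lessThan_iff)
  qed
  ultimately show ?thesis using prob by blast
qed

end
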